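(* Let $d>1$ be a square-free integer, let $K=\mathbb{Q}(\sqrt{-d})$ with ring of integers $\mathfrak{o}_K$, and let $\epsilon=x+y\sqrt{d}$ be the fundamental unit of $\mathbb{Q}(\sqrt{d})$, with $\mathcal{N}(\epsilon)=1$. Let $u=x+(y\sqrt{-d})i$ and let $$w\in\Big\{\,y\sqrt{-d}+xk,\ \ \tfrac{x+1}{2}-\tfrac{y\sqrt{-d}}{2}i+\tfrac{x-1}{2}j+\tfrac{y\sqrt{-d}}{2}k,\ \ x^2-(xy\sqrt{-d})i-(y^2d)j+(xy\sqrt{-d})k\,\Big\}.$$ Then $\langle u,w\rangle$ is a free subgroup of the unit group $\mathcal{U}\!\left(\left(\frac{-1,-1}{\mathfrak{o}_K}\right)\right)$.
   Context: $\left(\frac{-1,-1}{K}\right)=K[i,j: i^2=-1,\ j^2=-1,\ -ji=ij=:k]$ is the quaternion algebra over $K$, and $\left(\frac{-1,-1}{\mathfrak{o}_K}\right)$ is the $\mathfrak{o}_K$-span of $\{1,i,j,k\}$, a subring; $\mathcal{U}(R)$ denotes the group of units of a ring $R$. The norm of $\epsilon=x+y\sqrt{d}$ is $\mathcal{N}(\epsilon)=\epsilon\overline{\epsilon}=x^2-dy^2$, where $\overline{\epsilon}=x-y\sqrt{d}$. The fundamental unit of $\mathbb{Q}(\sqrt d)$ (called the "fundamental invertible") is the fundamental unit $\epsilon=x+y\sqrt d>1$ of its ring of integers, with $x,y>0$. $\langle u,w\rangle$ is the group generated by $u$ and $w$.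
   Formalization: Membership in the units over o_K is claimed only if x is an integer and, for the second w, (x+1)/2 is too; otherwise u or w is not in the order (d=21, x=5/2; d=3, x=2 with the second w). Freeness is proved in all cases in the units of the quaternion algebra over K. *)

theory Defs
  imports
    Complex_Main
    "HOL-Computational_Algebra.Polynomial"
    "HOL-Computational_Algebra.Squarefree"
    "HOL-Algebra.Ring"
    "HOL-Algebra.Generated_Groups"
begin

text \<open>
  \<open>Quat a b c e\<close> stands for \<open>a + b i + c j + e k\<close>. The multiplication is the bilinear one
  determined by \<open>i\<^sup>2 = j\<^sup>2 = -1\<close> and \<open>i j = -j i = k\<close>.
\<close>

datatype 'a quat = Quat (q1: 'a) (qi: 'a) (qj: 'a) (qk: 'a)

instantiation quat :: (comm_ring_1) ring_1
begin

definition "0 = Quat 0 0 0 0"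
definition "1 = Quat 1 0 0 0"
definition "- p = Quat (- q1 p) (- qi p) (- qj p) (- qk p)"
definition "p + q = Quat (q1 p + q1 q) (qi p + qi q) (qj p + qj q) (qk p + qk q)"
definition "p - q = Quat (q1 p - q1 q) (qi p - qi q) (qj p - qj q) (qk p - qk q)"
definition "p * q = Quat
  (q1 p * q1 q - qi p * qi q - qj p * qj q - qk p * qk q)
  (q1 p * qi q + qi p * q1 q + qj p * qk q - qk p * qj q)
  (q1 p * qj q - qi p * qk q + qj p * q1 q + qk p * qi q)
  (q1 p * qk q + qi p * qj q - qj p * qi q + qk p * q1 q)"

instance
  by standard
    (simp_all add: zero_quat_def one_quat_def uminus_quat_def plus_quat_def
      minus_quat_def times_quat_def algebra_simps)

end

lemma quat_basis_mult:
  fixes i j k :: "'a::comm_ring_1 quat"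
  defines "i \<equiv> Quat 0 1 0 0" and "j \<equiv> Quat 0 0 1 0" and "k \<equiv> Quat 0 0 0 1"
  shows "i * i = - 1" and "j * j = - 1" and "i * j = k" and "- (j * i) = i * j"
  unfolding i_def j_def k_def
  by (simp_all add: times_quat_def one_quat_def uminus_quat_def)

text \<open>
  For a subring \<open>S\<close> of a commutative ring, the \<open>S\<close>-span of \<open>1, i, j, k\<close>, that is,
  the quaternion ring \<open>(-1,-1 / S)\<close>.
\<close>

definition quat_ring :: "'a::comm_ring_1 set \<Rightarrow> 'a quat ring" where
  "quat_ring S =
    \<lparr>carrier = {Quat a b c e | a b c e. a \<in> S \<and> b \<in> S \<and> c \<in> S \<and> e \<in> S},
     mult = (*), one = 1, zero = 0, add = (+)\<rparr>"

text \<open>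
  \<open>quad_field r\<close> is the field generated over the rationals by a square root \<open>r\<close> of a rational number:
  \<open>r = sqrt d\<close> gives the real field, \<open>r = csqrt (- d)\<close> the imaginary one.
\<close>

definition quad_field :: "'a::field_char_0 \<Rightarrow> 'a set" where
  "quad_field r = {of_rat a + of_rat b * r | a b. True}"

definition quad_integers :: "'a::field_char_0 \<Rightarrow> 'a set" where
  "quad_integers r = {z \<in> quad_field r. algebraic_int z}"

definition quad_units :: "'a::field_char_0 \<Rightarrow> 'a set" where
  "quad_units r = {z \<in> quad_integers r. \<exists>z' \<in> quad_integers r. z * z' = 1}"

definition is_fundamental_unit :: "int \<Rightarrow> real \<Rightarrow> bool" where
  "is_fundamental_unit d \<epsilon> \<longleftrightarrow>
     \<epsilon> \<in> quad_units (sqrt (of_int d)) \<and> \<epsilon> > 1 \<and>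
     (\<forall>\<eta> \<in> quad_units (sqrt (of_int d)). \<exists>n::int. \<eta> = \<epsilon> powi n \<or> \<eta> = - (\<epsilon> powi n))"

text \<open>
  Words in the letters \<open>b\<close> and \<open>b\<^sup>-\<^sup>1\<close>: the pair \<open>(b, True)\<close> stands for \<open>b\<close> and \<open>(b, False)\<close>
  for its inverse.
\<close>

definition word_value :: "('a, 'm) monoid_scheme \<Rightarrow> ('a \<times> bool) list \<Rightarrow> 'a" where
  "word_value G ws =
     foldr (\<lambda>(b, s) g. (if s then b else inv\<^bsub>G\<^esub> b) \<otimes>\<^bsub>G\<^esub> g) ws \<one>\<^bsub>G\<^esub>"

definition reduced_word :: "('a \<times> bool) list \<Rightarrow> bool" where
  "reduced_word ws \<longleftrightarrow>
     (\<forall>n. Suc n < length ws \<longrightarrow>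
        \<not> (fst (ws ! n) = fst (ws ! Suc n) \<and> snd (ws ! n) \<noteq> snd (ws ! Suc n)))"

definition free_basis :: "('a, 'm) monoid_scheme \<Rightarrow> 'a set \<Rightarrow> bool" where
  "free_basis G B \<longleftrightarrow>
     group G \<and> B \<subseteq> carrier G \<and> generate G B = carrier G \<and>
     (\<forall>ws. fst ` set ws \<subseteq> B \<and> reduced_word ws \<and> ws \<noteq> [] \<longrightarrow> word_value G ws \<noteq> \<one>\<^bsub>G\<^esub>)"

definition freely_generate_subgroup ::
  "('a, 'm) monoid_scheme \<Rightarrow> 'a \<Rightarrow> 'a \<Rightarrow> bool" where
  "freely_generate_subgroup G u w \<longleftrightarrow>
     u \<noteq> w \<and> subgroup (generate G {u, w}) G \<and>
     free_basis (G\<lparr>carrier := generate G {u, w}\<rparr>) {u, w}"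

end

theory Submission
  imports Defs "Jordan_Normal_Form.Char_Poly"
begin

text \<open>
  Put \<open>t = y sqrt d\<close> and \<open>e = x + t\<close>, so \<open>x\<^sup>2 - t\<^sup>2 = 1\<close> and \<open>y sqrt (- d)\<close> is \<open>\<i> t\<close>. The complex
  quaternions act on \<open>\<complex>\<^sup>2\<close> so that \<open>u\<close> becomes the diagonal matrix with entries \<open>e\<close>, \<open>1 / e\<close>, and
  each \<open>w\<close> becomes a scalar times a real matrix. On the real projective line there are four
  disjoint intervals, attracting \<open>u\<close>, \<open>u\<^sup>-\<^sup>1\<close>, \<open>w\<close>, \<open>w\<^sup>-\<^sup>1\<close>, each generator mapping the complement of
  the interval of its inverse into its own interval; so the ping-pong argument applies. An interval
  is recorded by the binary quadratic form that is negative on it, and the mapping property becomes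
  a polynomial identity between two such forms. The intervals are disjoint because \<open>x \<ge> 2\<close>: the
  only smaller possibility, \<open>x = 3/2\<close> with \<open>d = 5\<close>, does not come from a fundamental unit.
\<close>

section \<open>Sums and products of algebraic integers\<close>

definition int_span :: "('i \<Rightarrow> 'a::ring_1) \<Rightarrow> 'i set \<Rightarrow> 'a set" where
  "int_span v I = {\<Sum>i\<in>I. of_int (c i) * v i | c. True}"

lemma int_span_base:
  assumes "finite I" "i \<in> I" shows "v i \<in> int_span v I"
proof -
  have "v i = (\<Sum>j\<in>I. of_int (if j = i then 1 else 0) * v j)"
    using assms by (simp add: if_distrib[of of_int] if_distrib[of "\<lambda>c. c * _"] cong: if_cong)
  then show ?thesis
    unfolding int_span_def by (intro CollectI exI[of _ "\<lambda>j. if j = i then 1 else 0"]) auto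
qed

lemma int_span_0: "0 \<in> int_span v I"
  unfolding int_span_def by (auto intro!: exI[of _ "\<lambda>_. 0"])

lemma int_span_add:
  assumes "a \<in> int_span v I" "b \<in> int_span v I" shows "a + b \<in> int_span v I"
proof -
  obtain c c' where "a = (\<Sum>i\<in>I. of_int (c i) * v i)" "b = (\<Sum>i\<in>I. of_int (c' i) * v i)"
    using assms unfolding int_span_def by auto
  then have "a + b = (\<Sum>i\<in>I. of_int (c i + c' i) * v i)"
    by (simp add: sum.distrib distrib_right)
  then show ?thesis unfolding int_span_def by (intro CollectI exI[of _ "\<lambda>i. c i + c' i"]) auto
qed

lemma int_span_scale:
  assumes "a \<in> int_span v I" shows "of_int n * a \<in> int_span v I"
proof -
  obtain c where "a = (\<Sum>i\<in>I. of_int (c i) * v i)"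
    using assms unfolding int_span_def by auto
  then have "of_int n * a = (\<Sum>i\<in>I. of_int (n * c i) * v i)"
    by (simp add: sum_distrib_left mult.assoc)
  then show ?thesis unfolding int_span_def by (intro CollectI exI[of _ "\<lambda>i. n * c i"]) auto
qed

lemma int_span_sum:
  "(\<And>k. k \<in> K \<Longrightarrow> f k \<in> int_span v I) \<Longrightarrow> (\<Sum>k\<in>K. f k) \<in> int_span v I"
  by (induction K rule: infinite_finite_induct) (auto simp: int_span_0 int_span_add)

lemma int_span_mult_closed:
  fixes z :: "'a::comm_ring_1"
  assumes "\<And>i. i \<in> I \<Longrightarrow> z * v i \<in> int_span v I" and "a \<in> int_span v I"
  shows "z * a \<in> int_span v I"
proof -
  obtain c where "a = (\<Sum>i\<in>I. of_int (c i) * v i)"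
    using assms unfolding int_span_def by auto
  then have "z * a = (\<Sum>i\<in>I. of_int (c i) * (z * v i))"
    by (simp add: sum_distrib_left mult_ac)
  then show ?thesis using assms(1) by (auto intro!: int_span_sum int_span_scale)
qed

text \<open>The vector \<open>v\<close> is an eigenvector of the integer matrix \<open>A\<close> for
  \<open>z\<close>, so \<open>z\<close> is a root of its characteristic polynomial, which is monic
  with integer coefficients.\<close>

lemma algebraic_int_if_eigenvalue:
  fixes z :: "'a::field_char_0" and n :: nat
  assumes ev: "\<And>i. i < n \<Longrightarrow> z * v i = (\<Sum>j<n. of_int (A i j) * v j)"
    and nz: "i0 < n" "v i0 \<noteq> 0"
  shows "algebraic_int z"
proof -
  define M :: "int mat" where "M = mat n n (\<lambda>(i, j). A i j)"
  define V where "V = vec n v"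
  have M: "M \<in> carrier_mat n n" by (simp add: M_def)
  have "eigenvector (map_mat of_int M) V z"
    unfolding eigenvector_def
  proof (intro conjI)
    show "V \<in> carrier_vec (dim_row (map_mat of_int M))" by (simp add: M_def V_def)
    have "V $ i0 \<noteq> 0" using nz by (simp add: V_def)
    then show "V \<noteq> 0\<^sub>v (dim_row (map_mat of_int M))" using nz by (auto simp: M_def)
    show "map_mat of_int M *\<^sub>v V = z \<cdot>\<^sub>v V"
      by (rule eq_vecI) (auto simp: M_def V_def scalar_prod_def ev atLeast0LessThan)
  qed
  then have "poly (char_poly (map_mat of_int M)) z = 0"
    using eigenvalue_root_char_poly[of "map_mat of_int M :: 'a mat" n z] M
    unfolding eigenvalue_def by auto
  then have "poly (map_poly of_int (char_poly M)) z = 0"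
    by (simp add: of_int_hom.char_poly_hom[OF M])
  moreover have "lead_coeff (char_poly M) = 1"
    using degree_monic_char_poly[OF M] by auto
  ultimately show ?thesis unfolding algebraic_int_altdef_ipoly by blast
qed

text \<open>Multiplication by \<open>z\<close> on the generators is given by an integer matrix; a
  numbering of \<open>I\<close> turns this into the eigenvector situation.\<close>

lemma algebraic_int_if_int_span:
  fixes z :: "'a::field_char_0"
  assumes "finite I" and "\<And>i. i \<in> I \<Longrightarrow> z * v i \<in> int_span v I" and "i0 \<in> I" "v i0 \<noteq> 0"
  shows "algebraic_int z"
proof -
  obtain h where h: "bij_betw h {..<card I} I"
    using ex_bij_betw_nat_finite[OF assms(1)] by (auto simp: atLeast0LessThan)
  have "\<forall>i\<in>I. \<exists>c. z * v i = (\<Sum>j\<in>I. of_int (c j) * v j)"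
    using assms(2) unfolding int_span_def by blast
  then obtain c where c: "\<And>i. i \<in> I \<Longrightarrow> z * v i = (\<Sum>j\<in>I. of_int (c i j) * v j)"
    by metis
  obtain k where k: "k < card I" "h k = i0"
    using bij_betw_imp_surj_on[OF h] assms(3) by (metis imageE lessThan_iff)
  show ?thesis
  proof (rule algebraic_int_if_eigenvalue)
    fix i assume "i < card I"
    then have "h i \<in> I" using h by (auto simp: bij_betw_def)
    then show "z * v (h i) = (\<Sum>j<card I. of_int (c (h i) (h j)) * v (h j))"
      using c sum.reindex_bij_betw[OF h, of "\<lambda>j. of_int (c (h i) j) * v j"] by simp
  qed (use k assms(4) in auto)
qed

lemma algebraic_int_power_reduce:
  fixes x :: "'a::field_char_0"
  assumes "algebraic_int x"
  obtains m c where "m > 0" "x ^ m = (\<Sum>i<m. of_int (c i) * x ^ i)"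
proof -
  obtain p :: "int poly" where p: "poly (map_poly of_int p) x = 0" "lead_coeff p = 1"
    using assms unfolding algebraic_int_altdef_ipoly by blast
  define m where "m = degree p"
  have "(\<Sum>i\<le>m. of_int (coeff p i) * x ^ i) = 0"
    using p by (simp add: poly_altdef m_def)
  then have s: "(\<Sum>i<m. of_int (coeff p i) * x ^ i) + x ^ m = 0"
    using p by (simp flip: lessThan_Suc_atMost add: m_def)
  \<comment> \<open>A monic constant polynomial is 1 and has no root.\<close>
  then have "m > 0" by (cases m) auto
  moreover have "x ^ m = (\<Sum>i<m. of_int (- coeff p i) * x ^ i)"
    using s by (simp only: of_int_minus mult_minus_left sum_negf add_eq_0_iff)
  ultimately show ?thesis by (rule that)
qed

text \<open>The monomials \<open>x ^ i * y ^ j\<close> with \<open>i < m\<close>,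
  \<open>j < n\<close> span a group stable under \<open>x\<close> and \<open>y\<close>, hence under
  their sum and product.\<close>

lemma
  fixes x y :: "'a::field_char_0"
  assumes "algebraic_int x" "algebraic_int y"
  shows algebraic_int_plus: "algebraic_int (x + y)"
    and algebraic_int_times: "algebraic_int (x * y)"
proof -
  obtain m c where m: "m > 0" "x ^ m = (\<Sum>i<m. of_int (c i) * x ^ i)"
    using algebraic_int_power_reduce[OF assms(1)] .
  obtain n b where n: "n > 0" "y ^ n = (\<Sum>i<n. of_int (b i) * y ^ i)"
    using algebraic_int_power_reduce[OF assms(2)] .
  define I where "I = {..<m} \<times> {..<n}"
  define v where "v = (\<lambda>(i, j). x ^ i * y ^ j)"
  have fin: "finite I" by (simp add: I_def)
  have 0: "(0, 0) \<in> I" "v (0, 0) \<noteq> 0" using m n by (auto simp: I_def v_def)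
  have base: "x ^ i * y ^ j \<in> int_span v I" if "i < m" "j < n" for i j
    using int_span_base[OF fin, of "(i, j)" v] that by (simp add: I_def v_def)
  have X: "x * v k \<in> int_span v I" if kI: "k \<in> I" for k
  proof -
    obtain i j where k: "k = (i, j)" "i < m" "j < n" using kI unfolding I_def by blast
    show ?thesis
    proof (cases "Suc i < m")
      case True
      then show ?thesis using base[of "Suc i" j] k by (simp add: v_def mult.assoc)
    next
      case False
      then have "Suc i = m" using k by simp
      then have "x * v k = x ^ m * y ^ j" using k by (auto simp: v_def mult.assoc)
      also have "\<dots> = (\<Sum>i<m. of_int (c i) * (x ^ i * y ^ j))"
        by (simp add: m sum_distrib_right mult.assoc)
      finally show ?thesis using base k by (auto intro!: int_span_sum int_span_scale)
    qed
  qed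
  have Y: "y * v k \<in> int_span v I" if kI: "k \<in> I" for k
  proof -
    obtain i j where k: "k = (i, j)" "i < m" "j < n" using kI unfolding I_def by blast
    show ?thesis
    proof (cases "Suc j < n")
      case True
      then show ?thesis using base[of i "Suc j"] k by (simp add: v_def mult_ac)
    next
      case False
      then have "Suc j = n" using k by simp
      then have "y * v k = x ^ i * y ^ n" using k by (auto simp: v_def mult_ac)
      also have "\<dots> = (\<Sum>j<n. of_int (b j) * (x ^ i * y ^ j))"
        by (simp add: n sum_distrib_left mult_ac)
      finally show ?thesis using base k by (auto intro!: int_span_sum int_span_scale)
    qed
  qed
  have "(x + y) * v k \<in> int_span v I" if "k \<in> I" for k
    using int_span_add[OF X[OF that] Y[OF that]] by (simp only: distrib_right)
  then show "algebraic_int (x + y)"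
    by (rule algebraic_int_if_int_span[of I "x + y" v, OF fin _ 0])
  have "x * y * v k \<in> int_span v I" if "k \<in> I" for k
    unfolding mult.assoc by (rule int_span_mult_closed[OF X Y[OF that]])
  then show "algebraic_int (x * y)"
    by (rule algebraic_int_if_int_span[of I "x * y" v, OF fin _ 0])
qed

section \<open>Groups of unit quaternions\<close>

definition is_subring :: "'a::comm_ring_1 set \<Rightarrow> bool" where
  "is_subring S \<longleftrightarrow> 1 \<in> S \<and> (\<forall>a\<in>S. \<forall>b\<in>S. a - b \<in> S \<and> a * b \<in> S)"

lemma is_subringD:
  assumes "is_subring S"
  shows "1 \<in> S" "0 \<in> S" "a \<in> S \<Longrightarrow> - a \<in> S"
    "a \<in> S \<Longrightarrow> b \<in> S \<Longrightarrow> a - b \<in> S" "a \<in> S \<Longrightarrow> b \<in> S \<Longrightarrow> a + b \<in> S"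
    "a \<in> S \<Longrightarrow> b \<in> S \<Longrightarrow> a * b \<in> S"
proof -
  have diff: "a - b \<in> S" if "a \<in> S" "b \<in> S" for a b
    using assms that unfolding is_subring_def by auto
  have 1: "1 \<in> S" using assms unfolding is_subring_def by auto
  show 0: "0 \<in> S" using diff[OF 1 1] by simp
  show neg: "- a \<in> S" if "a \<in> S" for a using diff[OF 0 that] by simp
  show "a + b \<in> S" if "a \<in> S" "b \<in> S" using diff[OF that(1) neg[OF that(2)]] by simp
  show "1 \<in> S" "a \<in> S \<Longrightarrow> b \<in> S \<Longrightarrow> a - b \<in> S" "a \<in> S \<Longrightarrow> b \<in> S \<Longrightarrow> a * b \<in> S"
    using assms unfolding is_subring_def by auto
qed

definition qcnj :: "'a::comm_ring_1 quat \<Rightarrow> 'a quat" where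
  "qcnj p = Quat (q1 p) (- qi p) (- qj p) (- qk p)"

definition qnorm :: "'a::comm_ring_1 quat \<Rightarrow> 'a" where
  "qnorm p = (q1 p)\<^sup>2 + (qi p)\<^sup>2 + (qj p)\<^sup>2 + (qk p)\<^sup>2"

lemma qcnj_mult:
  assumes "qnorm p = 1"
  shows "p * qcnj p = 1" "qcnj p * p = 1"
  using assms
  by (auto simp: qnorm_def qcnj_def times_quat_def one_quat_def power2_eq_square algebra_simps)

text \<open>\<open>word_value\<close> with conjugates for inverses, so that words in norm-one
  letters can be studied without reference to a group.\<close>

definition word_prod :: "('a::comm_ring_1 quat \<times> bool) list \<Rightarrow> 'a quat" where
  "word_prod ws = foldr (\<lambda>(b, s) g. (if s then b else qcnj b) * g) ws 1"

lemma Quat_in_quat_ring [simp]: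
  "Quat a b c e \<in> carrier (quat_ring S) \<longleftrightarrow> a \<in> S \<and> b \<in> S \<and> c \<in> S \<and> e \<in> S"
  by (auto simp: quat_ring_def)

lemma quat_ring_simps [simp]:
  "mult (quat_ring S) = (*)" "one (quat_ring S) = 1"
  by (simp_all add: quat_ring_def)

lemma monoid_quat_ring:
  assumes "is_subring S"
  shows "monoid (quat_ring S)"
proof (rule monoidI)
  fix p q assume "p \<in> carrier (quat_ring S)" "q \<in> carrier (quat_ring S)"
  then show "p \<otimes>\<^bsub>quat_ring S\<^esub> q \<in> carrier (quat_ring S)"
    by (cases p; cases q) (auto simp: times_quat_def intro!: is_subringD[OF assms])
next
  show "\<one>\<^bsub>quat_ring S\<^esub> \<in> carrier (quat_ring S)"
    by (simp add: one_quat_def is_subringD[OF assms])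
qed (simp_all add: mult.assoc)

text \<open>The conjugate of a norm-one element is its inverse and lies in the same ring. Word
  values in the generated subgroup are therefore given by \<open>word_prod\<close>.\<close>

lemma freely_generate_subgroup_quatI:
  assumes S: "is_subring S"
    and u: "u \<in> carrier (quat_ring S)" "qnorm u = 1"
    and w: "w \<in> carrier (quat_ring S)" "qnorm w = 1"
    and "u \<noteq> w"
    and free: "\<And>ws. fst ` set ws \<subseteq> {u, w} \<Longrightarrow> reduced_word ws \<Longrightarrow> ws \<noteq> [] \<Longrightarrow> word_prod ws \<noteq> 1"
  shows "freely_generate_subgroup (units_of (quat_ring S)) u w"
proof -
  define G where "G = units_of (quat_ring S)"
  interpret R: monoid "quat_ring S" by (rule monoid_quat_ring[OF S])
  interpret G: group G unfolding G_def by (rule R.units_group)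
  have G_simps: "mult G = (*)" "one G = 1"
    by (simp_all add: G_def units_of_mult units_of_one)
  have unit: "p \<in> carrier G \<and> inv\<^bsub>G\<^esub> p = qcnj p"
    if "p \<in> carrier (quat_ring S)" "qnorm p = 1" for p
  proof -
    have "qcnj p \<in> carrier (quat_ring S)"
      using that(1) by (cases p) (auto simp: qcnj_def intro: is_subringD[OF S])
    then have "p \<in> carrier G" "qcnj p \<in> carrier G"
      using that qcnj_mult[OF that(2)] by (auto simp: G_def units_of_carrier Units_def)
    then show ?thesis
      using G.inv_equality[of "qcnj p" p] qcnj_mult[OF that(2)] by (simp add: G_simps)
  qed
  define H where "H = generate G {u, w}"
  have uw: "{u, w} \<subseteq> carrier G" using unit u w by blast
  have sub: "subgroup H G"
    unfolding H_def by (rule G.generate_is_subgroup[OF uw])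
  have uwH: "{u, w} \<subseteq> H" unfolding H_def by (auto intro: generate.incl)
  have "word_value (G\<lparr>carrier := H\<rparr>) ws = word_prod ws" if "fst ` set ws \<subseteq> {u, w}" for ws
    using that
  proof (induction ws)
    case (Cons l ws)
    obtain b s where l: "l = (b, s)" by (cases l)
    then have b: "b \<in> {u, w}" using Cons.prems by auto
    then have "inv\<^bsub>G\<lparr>carrier := H\<rparr>\<^esub> b = qcnj b"
      using G.m_inv_consistent[OF sub] unit u w uwH by auto
    then show ?case using Cons by (simp add: word_value_def word_prod_def l G_simps)
  qed (simp add: word_value_def word_prod_def G_simps)
  then have "free_basis (G\<lparr>carrier := H\<rparr>) {u, w}"
    unfolding free_basis_def
    using G.subgroup_imp_group[OF sub] uwH free G.generate_consistent[OF uwH sub]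
    by (auto simp: H_def G_simps)
  then show ?thesis
    unfolding freely_generate_subgroup_def using sub \<open>u \<noteq> w\<close> by (simp add: G_def H_def)
qed

section \<open>Integers and units of quadratic fields\<close>

lemma quad_fieldI: "z = of_rat a + of_rat b * r \<Longrightarrow> z \<in> quad_field r"
  unfolding quad_field_def by blast

lemma is_subring_quad_field:
  assumes "r\<^sup>2 = of_rat D"
  shows "is_subring (quad_field r)"
  unfolding is_subring_def
proof (intro conjI ballI)
  show "1 \<in> quad_field r" by (rule quad_fieldI[of _ 1 0]) simp
  fix z1 z2 assume "z1 \<in> quad_field r" "z2 \<in> quad_field r"
  then obtain a1 b1 a2 b2
    where z: "z1 = of_rat a1 + of_rat b1 * r" "z2 = of_rat a2 + of_rat b2 * r"
    unfolding quad_field_def by blast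
  show "z1 - z2 \<in> quad_field r"
    by (rule quad_fieldI[of _ "a1 - a2" "b1 - b2"]) (simp add: z of_rat_diff algebra_simps)
  have "z1 * z2 = of_rat a1 * of_rat a2 + of_rat b1 * of_rat b2 * r\<^sup>2
      + (of_rat a1 * of_rat b2 + of_rat a2 * of_rat b1) * r"
    by (simp add: z algebra_simps power2_eq_square)
  then show "z1 * z2 \<in> quad_field r"
    by (intro quad_fieldI[of _ "a1 * a2 + b1 * b2 * D" "a1 * b2 + a2 * b1"])
      (simp add: assms of_rat_add of_rat_mult)
qed

lemma is_subring_quad_integers:
  assumes "r\<^sup>2 = of_rat D"
  shows "is_subring (quad_integers r)"
  using is_subring_quad_field[OF assms] algebraic_int_plus[of _ "- _"]
  unfolding is_subring_def quad_integers_def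
  by (auto simp: algebraic_int_times)

text \<open>It is a root of \<open>X^2 - X - 1\<close>, and its inverse
  \<open>(- 1 + sqrt 5) / 2\<close> is a root of \<open>X^2 + X - 1\<close>.\<close>

lemma golden_ratio_quad_unit: "(1 + sqrt 5) / 2 \<in> quad_units (sqrt 5)"
proof -
  have "algebraic_int ((1 + sqrt 5) / 2 :: real)"
    by (rule algebraic_int.intros[of "[:-1, -1, 1:]"])
      (auto simp: coeff_pCons field_simps split: nat.split)
  moreover have "algebraic_int ((- 1 + sqrt 5) / 2 :: real)"
    by (rule algebraic_int.intros[of "[:-1, 1, 1:]"])
      (auto simp: coeff_pCons field_simps split: nat.split)
  moreover have "(1 + sqrt 5) / 2 \<in> quad_field (sqrt 5)"
    by (rule quad_fieldI[of _ "1/2" "1/2"]) (simp add: of_rat_divide)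
  moreover have "(- 1 + sqrt 5) / 2 \<in> quad_field (sqrt 5)"
    by (rule quad_fieldI[of _ "-1/2" "1/2"]) (simp add: of_rat_divide of_rat_minus)
  moreover have "(1 + sqrt 5) * (- 1 + sqrt 5) = (4 :: real)"
    by (simp add: algebra_simps)
  then have "(1 + sqrt 5) / 2 * ((- 1 + sqrt 5) / 2) = (1 :: real)"
    by simp
  ultimately show ?thesis unfolding quad_units_def quad_integers_def by blast
qed

text \<open>With \<open>q = a / b\<close> in lowest terms, \<open>b\<^sup>2\<close> divides
  \<open>d * a\<^sup>2\<close>, hence \<open>d\<close>, so \<open>b\<close> is a unit.\<close>

lemma squarefree_rat_square_int:
  fixes d m :: int and q :: rat
  assumes "squarefree d" "of_int d * q\<^sup>2 = of_int m"
  shows "q \<in> \<int>"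
proof -
  obtain a b where q: "q = of_int a / of_int b" "b > 0" "coprime a b"
    using quotient_of_div quotient_of_denom_pos quotient_of_coprime by (metis surj_pair)
  have "of_int (d * a\<^sup>2) = (of_int (m * b\<^sup>2) :: rat)"
    using assms(2) q(2) by (simp add: q(1) field_simps)
  then have "d * a\<^sup>2 = m * b\<^sup>2" by (simp only: of_int_eq_iff)
  then have "b\<^sup>2 dvd d * a\<^sup>2" by simp
  moreover have "coprime (b\<^sup>2) (a\<^sup>2)" using q(3) by (simp add: coprime_commute)
  ultimately have "b\<^sup>2 dvd d" by (simp add: coprime_dvd_mult_left_iff)
  then have "is_unit b" using assms(1) by (auto simp: squarefree_def)
  then show ?thesis using q by simp
qed

text \<open>
  The only competitor below 2 is \<open>3/2\<close>, which forces \<open>d = 5\<close>; but \<open>(3 + sqrt 5) / 2\<close> is the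
  square of the golden ratio.
\<close>

lemma fundamental_unit_norm_one_ge_2:
  fixes d :: int and x y :: rat
  assumes d: "d > 1" "squarefree d"
    and fu: "is_fundamental_unit d (of_rat x + of_rat y * sqrt (of_int d))"
    and pos: "x > 0" "y > 0" and norm: "x\<^sup>2 - of_int d * y\<^sup>2 = 1"
  shows "x \<ge> 2"
proof -
  define r where "r = sqrt (of_int d)"
  define e where "e = of_rat x + of_rat y * r"
  have r2: "r * r = of_int d" using d by (simp add: r_def)
  have unit: "e \<in> quad_units r" and e1: "e > 1"
    and gen: "\<And>\<eta>. \<eta> \<in> quad_units r \<Longrightarrow> \<exists>n::int. \<eta> = e powi n \<or> \<eta> = - (e powi n)"
    using fu unfolding is_fundamental_unit_def e_def r_def by auto
  obtain z where z: "algebraic_int e" "algebraic_int z" "e * z = 1"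
    using unit unfolding quad_units_def quad_integers_def by auto
  \<comment> \<open>Norm one makes the conjugate the inverse, so the trace \<open>2 * x\<close> is a
    sum of two algebraic integers and, being rational, an integer.\<close>
  have "e * (of_rat x - of_rat y * r) = of_rat (x\<^sup>2 - of_int d * y\<^sup>2)"
    using r2 by (simp add: e_def algebra_simps power2_eq_square of_rat_diff of_rat_mult)
  then have "e * (of_rat x - of_rat y * r) = 1" by (simp add: norm)
  then have "z = of_rat x - of_rat y * r"
    using z(3) e1 by (metis mult_cancel_left not_one_less_zero)
  then have "algebraic_int (of_rat (2 * x) :: real)"
    using algebraic_int_plus[OF z(1,2)] by (simp add: e_def of_rat_mult)
  then have "(of_rat (2 * x) :: real) \<in> \<int>"
    by (rule rational_algebraic_int_is_int) simp
  then obtain n where "(of_rat (2 * x) :: real) = of_rat (of_int n)"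
    by (auto elim: Ints_cases)
  then have n: "2 * x = of_int n" by (simp only: of_rat_eq_iff)
  have "of_int d * y\<^sup>2 > 0" using d pos by (intro mult_pos_pos) auto
  then have "x\<^sup>2 > 1\<^sup>2" using norm by simp
  then have "x > 1" by (rule power_less_imp_less_base) (use pos in simp)
  then have "of_int n > (of_int 2 :: rat)" using n by linarith
  then have "n \<ge> 3" by (simp only: of_int_less_iff)
  moreover have "n \<noteq> 3"
  proof
    assume "n = 3"
    then have x: "x = 3 / 2" using n by simp
    then have q: "of_int d * (2 * y)\<^sup>2 = of_int 5"
      using norm unfolding x by (simp add: power2_eq_square)
    obtain a where a: "2 * y = of_int a"
      using squarefree_rat_square_int[OF d(2) q] by (rule Ints_cases)
    have "of_int (d * a\<^sup>2) = (of_int 5 :: rat)" using q unfolding a by simp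
    then have da: "d * a\<^sup>2 = 5" by (simp only: of_int_eq_iff)
    have "(of_int 0 :: rat) < of_int a" using a pos by simp
    then have "a > 0" by (simp only: of_int_less_iff)
    have "a < 2"
    proof (rule ccontr)
      assume "\<not> a < 2"
      then have "2\<^sup>2 \<le> a\<^sup>2" by (intro power_mono) auto
      then have "2 * 4 \<le> d * a\<^sup>2" using d by (intro mult_mono) auto
      then show False using da by simp
    qed
    then have "a = 1" using \<open>a > 0\<close> by simp
    then have d5: "d = 5" and y: "y = 1 / 2" using da a by auto
    define \<phi> where "\<phi> = (1 + sqrt 5) / 2"
    have r5: "r = sqrt 5" by (simp add: r_def d5)
    \<comment> \<open>The golden ratio lies strictly between \<open>e powi 0\<close> and
      \<open>e powi 1\<close>, so it is no integer power of \<open>e\<close>.\<close>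
    have e\<phi>: "e = \<phi> + 1"
      by (simp add: e_def x y r5 \<phi>_def of_rat_divide add_divide_distrib)
    have \<phi>1: "\<phi> > 1" by (simp add: \<phi>_def)
    obtain k where "\<phi> = e powi k \<or> \<phi> = - (e powi k)"
      using gen[of \<phi>] golden_ratio_quad_unit by (auto simp: r5 \<phi>_def)
    moreover have "e powi k > 0" using e1 by simp
    ultimately have k: "\<phi> = e powi k" using \<phi>1 by linarith
    show False
    proof (cases "k \<le> 0")
      case True
      then have "e powi k \<le> e powi 0" using e1 by (intro power_int_increasing) auto
      then show ?thesis unfolding k[symmetric] using \<phi>1 by simp
    next
      case False
      then have "e powi 1 \<le> e powi k" using e1 by (intro power_int_increasing) auto
      then show ?thesis unfolding k[symmetric] by (simp add: e\<phi>)
    qed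
  qed
  ultimately have "n \<ge> 4" by simp
  then have "(of_int 4 :: rat) \<le> of_int n" by (simp only: of_int_le_iff)
  then show ?thesis using n by linarith
qed

section \<open>Ping-pong on the projective line\<close>

text \<open>\<open>\<i> i\<close>, \<open>\<i> j\<close>, \<open>\<i> k\<close> act as the Pauli matrices up to sign, ordered so as to make \<open>\<i> i\<close> diagonal.\<close>

definition act :: "complex quat \<Rightarrow> complex \<times> complex \<Rightarrow> complex \<times> complex" where
  "act g v = ((q1 g - \<i> * qi g) * fst v + (qj g - \<i> * qk g) * snd v,
              (- qj g - \<i> * qk g) * fst v + (q1 g + \<i> * qi g) * snd v)"

lemma act_mult: "act (g * h) v = act g (act h v)"
  by (simp add: act_def times_quat_def algebra_simps)

lemma act_one: "act 1 v = v"
  by (simp add: act_def one_quat_def)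

lemma act_scale: "act g (c * a, c * b) = (c * fst (act g (a, b)), c * snd (act g (a, b)))"
  by (simp add: act_def algebra_simps)

lemma reduced_word_ConsD:
  assumes "reduced_word ((b, s) # ws)"
  shows "reduced_word ws"
    and "ws = (b', s') # ws' \<Longrightarrow> \<not> (b = b' \<and> s \<noteq> s')"
proof -
  show "reduced_word ws"
    unfolding reduced_word_def
  proof (intro allI impI)
    fix n assume "Suc n < length ws"
    then show "\<not> (fst (ws ! n) = fst (ws ! Suc n) \<and> snd (ws ! n) \<noteq> snd (ws ! Suc n))"
      using assms[unfolded reduced_word_def, rule_format, of "Suc n"] by simp
  qed
  show "\<not> (b = b' \<and> s \<noteq> s')" if "ws = (b', s') # ws'"
    using assms[unfolded reduced_word_def, rule_format, of 0] that by simp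
qed

text \<open>The letter \<open>(b, s)\<close> owns the points where \<open>F b s\<close> is negative.
  By induction, a nonempty reduced word moves the base point, which lies in no region, into the
  region of its first letter. Points are real pairs up to a complex scalar \<open>c\<close>, since a
  letter may act by a real matrix only up to a scalar.\<close>

lemma ping_pong_words:
  fixes F :: "complex quat \<Rightarrow> bool \<Rightarrow> real \<Rightarrow> real \<Rightarrow> real"
  assumes hom: "\<And>b s c p q. F b s (c * p) (c * q) = c\<^sup>2 * F b s p q"
    and step: "\<And>b s p q. b \<in> B \<Longrightarrow> F b (\<not> s) p q > 0 \<Longrightarrow>
      \<exists>c p' q'. act (if s then b else qcnj b) (of_real p, of_real q) = (c * of_real p', c * of_real q')
        \<and> F b s p' q' < 0"
    and disj: "\<And>b s b' s' p q. b \<in> B \<Longrightarrow> b' \<in> B \<Longrightarrow> (b, s) \<noteq> (b', s') \<Longrightarrow>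
      F b s p q < 0 \<Longrightarrow> F b' s' p q > 0"
    and base: "\<And>b s. b \<in> B \<Longrightarrow> F b s p0 q0 > 0"
    and ws: "fst ` set ws \<subseteq> B" "reduced_word ws" "ws \<noteq> []"
  shows "word_prod ws \<noteq> 1"
proof
  have "\<exists>c p q. act (word_prod ws) (of_real p0, of_real q0) = (c * of_real p, c * of_real q)
      \<and> F (fst (hd ws)) (snd (hd ws)) p q < 0"
    using ws
  proof (induction ws)
    case (Cons l ws)
    obtain b s where l: "l = (b, s)" by (cases l)
    then have b: "b \<in> B" using Cons.prems by auto
    define g where "g = (if s then b else qcnj b)"
    have prod: "word_prod (l # ws) = g * word_prod ws"
      by (simp add: word_prod_def l g_def)
    have "\<exists>c p q. act (word_prod ws) (of_real p0, of_real q0) = (c * of_real p, c * of_real q)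
        \<and> F b (\<not> s) p q > 0"
    proof (cases ws)
      case Nil
      then show ?thesis
        using base[OF b] by (intro exI[of _ 1] exI[of _ p0] exI[of _ q0])
          (simp add: word_prod_def act_one)
    next
      case (Cons l' ws')
      obtain b' s' where l': "l' = (b', s')" by (cases l')
      have b': "b' \<in> B" using Cons.prems Cons l' by auto
      have red: "reduced_word ((b, s) # ws)" using Cons.prems(2) l by simp
      \<comment> \<open>\<open>(b, \<not> s)\<close> is the inverse letter, which cannot come next
        in a reduced word; the image so far is thus outside its region.\<close>
      have ne: "(b', s') \<noteq> (b, \<not> s)"
        using reduced_word_ConsD(2)[OF red, of b' s' ws'] Cons l' by blast
      obtain c p q
        where v: "act (word_prod ws) (of_real p0, of_real q0) = (c * of_real p, c * of_real q)"
          and "F b' s' p q < 0"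
        using Cons.IH Cons.prems(1) reduced_word_ConsD(1)[OF red] Cons l' by auto
      then have "F b (\<not> s) p q > 0" by (intro disj[OF b' b ne])
      then show ?thesis using v by auto
    qed
    then obtain c p q
      where v: "act (word_prod ws) (of_real p0, of_real q0) = (c * of_real p, c * of_real q)"
        and "F b (\<not> s) p q > 0" by blast
    then obtain c' p' q' where "act g (of_real p, of_real q) = (c' * of_real p', c' * of_real q')"
      and F: "F b s p' q' < 0"
      using step[OF b] unfolding g_def by blast
    then have "act (word_prod (l # ws)) (of_real p0, of_real q0)
        = (c * c' * of_real p', c * c' * of_real q')"
      by (simp add: prod act_mult v act_scale mult.assoc)
    then show ?case using F l by auto
  qed simp
  then obtain c p q b s
    where v: "act (word_prod ws) (of_real p0, of_real q0) = (c * of_real p, c * of_real q)"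
      and F: "F b s p q < 0" and b: "b \<in> B"
    using ws by (metis image_subset_iff list.set_sel(1))
  assume "word_prod ws = 1"
  then have eq: "of_real p0 = c * of_real p" "of_real q0 = c * of_real q"
    using v by (auto simp: act_one)
  \<comment> \<open>As the form vanishes at the origin, \<open>(p, q)\<close> has a nonzero
    coordinate, which shows that \<open>c\<close> is a real number \<open>r\<close>; scaling by
    \<open>r\<close> cannot make a negative value positive.\<close>
  have "F b s 0 0 = 0" using hom[of b s 0 0 0] by simp
  then have nz: "p \<noteq> 0 \<or> q \<noteq> 0" using F by auto
  define r where "r = (if p \<noteq> 0 then p0 / p else q0 / q)"
  have "c = of_real r" using eq nz by (auto simp: r_def field_simps)
  then have "p0 = r * p" "q0 = r * q" using eq by (simp_all flip: of_real_mult)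
  then have "F b s p0 q0 = r\<^sup>2 * F b s p q" using hom by simp
  also have "\<dots> \<le> 0" using F by (intro mult_nonneg_nonpos) auto
  finally show False using base[OF b, of s] by simp
qed

text \<open>The action of \<open>g\<close> is \<open>\<mu>\<close> times the real matrix with rows
  \<open>a\<close>, \<open>b\<close> and \<open>c\<close>, \<open>d\<close>. Slopes do not see the
  scalar, which absorbs the factor \<open>\<i>\<close> in the matrix of \<open>W1\<close>
  below.\<close>

definition has_matrix ::
  "complex quat \<Rightarrow> complex \<Rightarrow> real \<Rightarrow> real \<Rightarrow> real \<Rightarrow> real \<Rightarrow> bool" where
  "has_matrix g \<mu> a b c d \<longleftrightarrow>
     q1 g - \<i> * qi g = \<mu> * of_real a \<and> qj g - \<i> * qk g = \<mu> * of_real b \<and>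
     - qj g - \<i> * qk g = \<mu> * of_real c \<and> q1 g + \<i> * qi g = \<mu> * of_real d"

lemma act_has_matrix:
  assumes "has_matrix g \<mu> a b c d"
  shows "act g (of_real p, of_real q) = (\<mu> * of_real (a * p + b * q), \<mu> * of_real (c * p + d * q))"
proof -
  have m: "q1 g - \<i> * qi g = \<mu> * of_real a" "qj g - \<i> * qk g = \<mu> * of_real b"
    "- qj g - \<i> * qk g = \<mu> * of_real c" "q1 g + \<i> * qi g = \<mu> * of_real d"
    using assms unfolding has_matrix_def by blast+
  show ?thesis unfolding act_def m by (simp add: algebra_simps)
qed

lemma has_matrix_qcnj:
  assumes "has_matrix g \<mu> a b c d"
  shows "has_matrix (qcnj g) \<mu> d (- b) (- c) a"
proof -
  have "- (qj g - \<i> * qk g) = - (\<mu> * of_real b)" "- (- qj g - \<i> * qk g) = - (\<mu> * of_real c)"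
    using assms unfolding has_matrix_def by simp_all
  then show ?thesis
    using assms by (simp add: has_matrix_def qcnj_def add.commute)
qed

text \<open>One identity serves both directions. The matrix of \<open>qcnj g\<close> is the
  adjugate, so the matrix of \<open>g\<close> returns its image to \<open>(p, q)\<close> up to the
  determinant; the identity at that image gives the claim for the inverse.\<close>

lemma ping_pong_step:
  fixes F :: "bool \<Rightarrow> real \<Rightarrow> real \<Rightarrow> real"
  assumes hom: "\<And>s r p q. F s (r * p) (r * q) = r\<^sup>2 * F s p q"
    and mat: "has_matrix g \<mu> a b c d" "a * d - b * c \<noteq> 0"
    and F: "\<And>p q. F True (a * p + b * q) (c * p + d * q) = - k * F False p q" "k > 0"
    and pos: "F (\<not> s) p q > 0"
  shows "\<exists>\<mu>' p' q'. act (if s then g else qcnj g) (of_real p, of_real q)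
      = (\<mu>' * of_real p', \<mu>' * of_real q') \<and> F s p' q' < 0"
proof (cases s)
  case True
  then have "F s (a * p + b * q) (c * p + d * q) < 0"
    using F pos by (simp add: mult_pos_pos)
  then show ?thesis using act_has_matrix[OF mat(1), of p q] True by (simp del: of_real_add of_real_mult) blast
next
  case False
  define p' q' where "p' = d * p + - b * q" and "q' = - c * p + a * q"
  have "a * p' + b * q' = (a * d - b * c) * p" "c * p' + d * q' = (a * d - b * c) * q"
    by (simp_all add: p'_def q'_def algebra_simps)
  then have "- k * F False p' q' = (a * d - b * c)\<^sup>2 * F True p q"
    using F(1)[of p' q'] hom by simp
  also have "\<dots> > 0" using mat(2) pos False by simp
  finally have "F s p' q' < 0"
    using F(2) False by (simp add: mult_less_0_iff)
  then show ?thesis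
    using act_has_matrix[OF has_matrix_qcnj[OF mat(1)], of p q] False
    unfolding p'_def[symmetric] q'_def[symmetric] by (simp del: of_real_add of_real_mult) blast
qed

text \<open>For \<open>a < b\<close> the form is negative on the slopes \<open>p / q\<close> between
  \<open>a\<close> and \<open>b\<close>. Its negative records the complementary interval through
  infinity, where \<open>q = 0\<close> and the form is \<open>p\<^sup>2\<close>.\<close>

definition slope_form :: "real \<Rightarrow> real \<Rightarrow> real \<Rightarrow> real \<Rightarrow> real" where
  "slope_form a b p q = (p - a * q) * (p - b * q)"

lemma slope_form_scale: "slope_form a b (r * p) (r * q) = r\<^sup>2 * slope_form a b p q"
  by (simp add: slope_form_def power2_eq_square algebra_simps)

lemma slope_form_expand: "slope_form a b p q = p\<^sup>2 - (a + b) * (p * q) + a * b * q\<^sup>2"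
  by (simp add: slope_form_def power2_eq_square algebra_simps)

lemma slope_form_homogenize:
  assumes "q \<noteq> 0"
  shows "slope_form a b p q = q\<^sup>2 * ((p / q - a) * (p / q - b))"
  using slope_form_scale[of a b q "p / q" 1] assms by (simp add: slope_form_def)

lemma slope_form_neg_iff:
  assumes "a < b"
  shows "slope_form a b p q < 0 \<longleftrightarrow> q \<noteq> 0 \<and> a < p / q \<and> p / q < b"
proof (cases "q = 0")
  case True
  then show ?thesis by (simp add: slope_form_def not_less)
next
  case False
  then have "slope_form a b p q < 0 \<longleftrightarrow> (p / q - a) * (p / q - b) < 0"
    unfolding slope_form_homogenize[OF False] by (simp add: mult_less_0_iff)
  also have "\<dots> \<longleftrightarrow> a < p / q \<and> p / q < b"
    using assms by (auto simp: mult_less_0_iff)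
  finally show ?thesis using False by simp
qed

lemma slope_form_pos_iff:
  assumes "a < b" "q \<noteq> 0"
  shows "slope_form a b p q > 0 \<longleftrightarrow> p / q < a \<or> b < p / q"
proof -
  have "slope_form a b p q > 0 \<longleftrightarrow> (p / q - a) * (p / q - b) > 0"
    unfolding slope_form_homogenize[OF assms(2)] using assms(2) by (simp add: zero_less_mult_iff)
  also have "\<dots> \<longleftrightarrow> p / q < a \<or> b < p / q"
    using assms(1) by (auto simp: zero_less_mult_iff)
  finally show ?thesis .
qed

lemma slope_form_disjoint:
  assumes "a < b" "b < a'" "a' < b'"
  shows "slope_form a b p q < 0 \<Longrightarrow> slope_form a' b' p q > 0"
    and "slope_form a' b' p q < 0 \<Longrightarrow> slope_form a b p q > 0"
  using assms by (auto simp: slope_form_neg_iff slope_form_pos_iff)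

lemma slope_form_nested:
  assumes "a < a'" "a' < b'" "b' < b"
  shows "slope_form a' b' p q < 0 \<Longrightarrow> slope_form a b p q < 0"
    and "slope_form a b p q > 0 \<Longrightarrow> slope_form a' b' p q > 0"
proof -
  show "slope_form a b p q < 0" if "slope_form a' b' p q < 0"
    using that assms by (auto simp: slope_form_neg_iff)
  show "slope_form a' b' p q > 0" if "slope_form a b p q > 0"
  proof (cases "q = 0")
    case True
    then show ?thesis using that by (simp add: slope_form_def)
  next
    case False
    then show ?thesis using that assms by (auto simp: slope_form_pos_iff)
  qed
qed

text \<open>The interval through infinity, outside \<open>l0\<close> and \<open>l7\<close>, belongs
  to \<open>u\<close>, and the one from \<open>l3\<close> to \<open>l4\<close> to its inverse. The
  other two belong to \<open>w\<close> and its inverse; \<open>o'\<close> is the sign that gets the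
  right-hand one. The base point is the middle of the gap from \<open>l4\<close> to
  \<open>l5\<close>.\<close>

lemma ping_pong_intervals:
  fixes l0 l1 l2 l3 l4 l5 l6 l7 :: real and o' :: bool
  assumes order: "l0 < l1" "l1 < l2" "l2 < l3" "l3 < l4" "l4 < l5" "l5 < l6" "l6 < l7"
    and "u \<noteq> w"
    and Fu_def: "Fu = (\<lambda>s. if s then \<lambda>p q. - slope_form l0 l7 p q else slope_form l3 l4)"
    and Fw_def: "Fw = (\<lambda>s. if s = o' then slope_form l5 l6 else slope_form l1 l2)"
    and u: "has_matrix u \<mu> a b c d" "a * d - b * c \<noteq> 0" "k > 0"
      "\<And>p q. Fu True (a * p + b * q) (c * p + d * q) = - k * Fu False p q"
    and w: "has_matrix w \<mu>' a' b' c' d'" "a' * d' - b' * c' \<noteq> 0" "k' > 0"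
      "\<And>p q. Fw True (a' * p + b' * q) (c' * p + d' * q) = - k' * Fw False p q"
    and ws: "fst ` set ws \<subseteq> {u, w}" "reduced_word ws" "ws \<noteq> []"
  shows "word_prod ws \<noteq> 1"
proof (rule ping_pong_words[where F = "\<lambda>g. if g = u then Fu else Fw" and ?p0.0 = "(l4 + l5) / 2"
      and ?q0.0 = 1, OF _ _ _ _ ws])
  show "(if g = u then Fu else Fw) s (r * p) (r * q) = r\<^sup>2 * (if g = u then Fu else Fw) s p q" for g s r p q
    by (simp add: Fu_def Fw_def slope_form_scale)
  have Fu_scale: "Fu s (r * p) (r * q) = r\<^sup>2 * Fu s p q" for s r p q
    by (simp add: Fu_def slope_form_scale)
  have Fw_scale: "Fw s (r * p) (r * q) = r\<^sup>2 * Fw s p q" for s r p q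
    by (simp add: Fw_def slope_form_scale)
  show "\<exists>c p' q'. act (if s then g else qcnj g) (of_real p, of_real q) = (c * of_real p', c * of_real q')
      \<and> (if g = u then Fu else Fw) s p' q' < 0"
    if "g \<in> {u, w}" "0 < (if g = u then Fu else Fw) (\<not> s) p q" for g s p q
  proof (cases "g = u")
    case True
    have "Fu (\<not> s) p q > 0" using that(2) True by simp
    from ping_pong_step[of Fu, OF Fu_scale u(1,2,4,3) this]
    show ?thesis by (simp only: True if_True simp_thms)
  next
    case False
    have "Fw (\<not> s) p q > 0" using that(2) False by simp
    from ping_pong_step[of Fw, OF Fw_scale w(1,2,4,3) this]
    moreover have "g = w" using that(1) False by simp
    ultimately show ?thesis by (simp only: if_False \<open>u \<noteq> w\<close>[symmetric])
  qed
  \<comment> \<open>Disjointness from the interval through infinity means nesting between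
    \<open>l0\<close> and \<open>l7\<close>.\<close>
  have 1: "slope_form l3 l4 p q < 0 \<Longrightarrow> slope_form l0 l7 p q < 0"
    "slope_form l5 l6 p q < 0 \<Longrightarrow> slope_form l0 l7 p q < 0"
    "slope_form l1 l2 p q < 0 \<Longrightarrow> slope_form l0 l7 p q < 0"
    "slope_form l0 l7 p q > 0 \<Longrightarrow> slope_form l3 l4 p q > 0"
    "slope_form l0 l7 p q > 0 \<Longrightarrow> slope_form l5 l6 p q > 0"
    "slope_form l0 l7 p q > 0 \<Longrightarrow> slope_form l1 l2 p q > 0" for p q
    using slope_form_nested[of l0 l3 l4 l7 p q] slope_form_nested[of l0 l5 l6 l7 p q]
      slope_form_nested[of l0 l1 l2 l7 p q] order by linarith+
  have 2: "slope_form l1 l2 p q < 0 \<Longrightarrow> slope_form l3 l4 p q > 0"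
    "slope_form l3 l4 p q < 0 \<Longrightarrow> slope_form l1 l2 p q > 0"
    "slope_form l1 l2 p q < 0 \<Longrightarrow> slope_form l5 l6 p q > 0"
    "slope_form l5 l6 p q < 0 \<Longrightarrow> slope_form l1 l2 p q > 0"
    "slope_form l3 l4 p q < 0 \<Longrightarrow> slope_form l5 l6 p q > 0"
    "slope_form l5 l6 p q < 0 \<Longrightarrow> slope_form l3 l4 p q > 0" for p q
    using slope_form_disjoint[of l1 l2 l3 l4 p q] slope_form_disjoint[of l1 l2 l5 l6 p q]
      slope_form_disjoint[of l3 l4 l5 l6 p q] order by linarith+
  show "(if g' = u then Fu else Fw) s' p q > 0"
    if "g \<in> {u, w}" "g' \<in> {u, w}" "(g, s) \<noteq> (g', s')" "(if g = u then Fu else Fw) s p q < 0"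
    for g s g' s' p q
    using that \<open>u \<noteq> w\<close>
    by (cases s; cases s'; cases o') (auto simp: Fu_def Fw_def intro: 1 2)
  have "slope_form l0 l7 ((l4 + l5) / 2) 1 < 0"
    using order by (subst slope_form_neg_iff) auto
  moreover have "slope_form l1 l2 ((l4 + l5) / 2) 1 > 0" "slope_form l3 l4 ((l4 + l5) / 2) 1 > 0"
    "slope_form l5 l6 ((l4 + l5) / 2) 1 > 0"
    using order by (auto simp: slope_form_pos_iff)
  ultimately show "(if g = u then Fu else Fw) s ((l4 + l5) / 2) 1 > 0" for g s
    by (simp add: Fu_def Fw_def)
qed

text \<open>Since \<open>u\<close> multiplies slopes by \<open>e\<^sup>2\<close>, it takes the
  exterior of the interval from \<open>l3\<close> to \<open>l4\<close> to the exterior of its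
  multiple; the outer endpoints are forced by the inner ones.\<close>

lemma ping_pong_translation:
  fixes e l1 l2 l3 l4 l5 l6 :: real and o' :: bool
  assumes e: "e > 0" and u: "has_matrix u 1 e 0 0 (1 / e)"
    and order: "e\<^sup>2 * l3 < l1" "l1 < l2" "l2 < l3" "l3 < l4" "l4 < l5" "l5 < l6" "l6 < e\<^sup>2 * l4"
    and "u \<noteq> w"
    and Fw_def: "Fw = (\<lambda>s. if s = o' then slope_form l5 l6 else slope_form l1 l2)"
    and w: "has_matrix w \<mu> a b c d" "a * d - b * c \<noteq> 0" "k > 0"
      "\<And>p q. Fw True (a * p + b * q) (c * p + d * q) = - k * Fw False p q"
    and ws: "fst ` set ws \<subseteq> {u, w}" "reduced_word ws" "ws \<noteq> []"
  shows "word_prod ws \<noteq> 1"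
proof -
  define Fu where
    "Fu = (\<lambda>s. if s then \<lambda>p q. - slope_form (e\<^sup>2 * l3) (e\<^sup>2 * l4) p q else slope_form l3 l4)"
  have F: "Fu True (e * p + 0 * q) (0 * p + 1 / e * q) = - e\<^sup>2 * Fu False p q" for p q
    using e by (simp add: Fu_def slope_form_def power2_eq_square field_simps)
  have "e * (1 / e) - 0 * 0 \<noteq> 0" "e\<^sup>2 > 0" using e by simp_all
  then show ?thesis
    using ping_pong_intervals[where Fu = Fu and Fw = Fw and a = e and b = 0 and c = 0 and d = "1 / e"
        and a' = a and b' = b and c' = c and d' = d, OF order \<open>u \<noteq> w\<close> Fu_def Fw_def u _ _ F w ws] by simp
qed

section \<open>The generators\<close>

text \<open>What ping-pong retains of the arithmetic: \<open>e\<close> is the fundamental unit and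
  \<open>e'\<close> its conjugate and inverse. The bound on \<open>x\<close> gives the room between
  the intervals.\<close>

locale hyperbola_point =
  fixes x t e e' :: real
  assumes norm: "x\<^sup>2 - t\<^sup>2 = 1" and x2: "x \<ge> 2" and t0: "t > 0"
  defines "e \<equiv> x + t" and "e' \<equiv> x - t"
begin

lemma ee': "e * e' = 1" and e'_eq: "1 / e = e'" and e_ge: "e \<ge> 37/10"
proof -
  show 1: "e * e' = 1" using norm by (simp add: e_def e'_def power2_eq_square algebra_simps)
  have "x\<^sup>2 \<ge> 2\<^sup>2" using x2 by (intro power_mono) auto
  \<comment> \<open>17/10 is a rational just below \<open>sqrt 3\<close>.\<close>
  then have "(17/10)\<^sup>2 < t\<^sup>2" using norm by (simp add: power2_eq_square)
  then have "17/10 < t" by (rule power_less_imp_less_base) (use t0 in simp)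
  then show "e \<ge> 37/10" using x2 by (simp add: e_def)
  then show "1 / e = e'" using 1 by (simp add: field_simps)
qed

lemma ee'_powers: "e\<^sup>2 * e' = e" "e'\<^sup>2 * e = e'" "e\<^sup>2 * e'^3 = e'"
proof -
  have "e\<^sup>2 * e' = e * (e * e')" "e'\<^sup>2 * e = e' * (e * e')" "e\<^sup>2 * e'^3 = (e * e')\<^sup>2 * e'"
    by (simp_all add: power2_eq_square power3_eq_cube mult_ac)
  then show "e\<^sup>2 * e' = e" "e'\<^sup>2 * e = e'" "e\<^sup>2 * e'^3 = e'" unfolding ee' by simp_all
qed

text \<open>Let \<open>v\<close> be the matrix with diagonal \<open>x\<close> and off-diagonal
  \<open>t\<close>. In the coordinate \<open>(p - q) / (p + q)\<close> it divides by
  \<open>e\<^sup>2\<close>; the slopes \<open>R\<close>, \<open>R'\<close> have coordinates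
  \<open>- 1 / e\<close>, \<open>1 / e\<close>, and \<open>- R\<close>, \<open>- R'\<close> have
  \<open>- e\<close>, \<open>e\<close>. So \<open>v\<close> maps the complement of the interval from
  \<open>- R'\<close> to \<open>- R\<close> onto that from \<open>R\<close> to
  \<open>R'\<close>.\<close>

definition R where "R = (e - 1) / (e + 1)"
definition R' where "R' = (e + 1) / (e - 1)"

lemma R_facts: "R * R' = 1" "(R + R') * t = 2 * x" "0 < R" "R < R'" "R' < e" "e' < R"
proof -
  have e: "e - 1 > 0" "e + 1 > 0" using e_ge by auto
  show 1: "R * R' = 1" using e by (simp add: R_def R'_def)
  show R0: "0 < R" using e by (simp add: R_def)
  have R1: "R < 1" "R' > 1" using e by (simp_all add: R_def R'_def)
  then show "R < R'" by simp
  have "R * (e + 1) = e - 1" "R' * (e - 1) = e + 1" using e by (simp_all add: R_def R'_def)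
  moreover have "(R + R') * ((e + 1) * (e - 1)) = R * (e + 1) * (e - 1) + R' * (e - 1) * (e + 1)"
    by (simp add: algebra_simps)
  ultimately have "(R + R') * ((e + 1) * (e - 1)) = (e - 1) * (e - 1) + (e + 1) * (e + 1)"
    by simp
  moreover have "(e + 1) * (e - 1) = 2 * t * e" "(e - 1) * (e - 1) + (e + 1) * (e + 1) = 4 * x * e"
    using norm by (simp_all add: e_def power2_eq_square algebra_simps)
  ultimately have "(R + R') * (2 * t * e) = 4 * x * e" by (simp only:)
  then have "(R + R') * t * (2 * e) = 2 * x * (2 * e)" by (simp add: algebra_simps)
  then show "(R + R') * t = 2 * x" using e unfolding mult_cancel_right by auto
  \<comment> \<open>\<open>R' < e\<close> holds as soon as \<open>e > 1 + sqrt 2\<close>; taking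
    reciprocals then gives \<open>e' < R\<close>.\<close>
  have "e * (e - 1) \<ge> 37/10 * (e - 1)" using e_ge by (intro mult_right_mono) auto
  then have "e + 1 < e * (e - 1)" using e_ge by simp
  then show R'e: "R' < e" using e by (simp add: R'_def field_simps)
  have "e' > 0" using e_ge by (simp flip: e'_eq)
  then have "e' * (R * R') < e' * (R * e)" using R'e R0 by simp
  moreover have "e' * (R * e) = e * e' * R" by simp
  ultimately show "e' < R" unfolding 1 ee' by simp
qed

text \<open>As \<open>R * R' = 1\<close>, the left side is the form of \<open>R\<close>,
  \<open>R'\<close> at the image of \<open>(p, q)\<close> under \<open>v\<close>, with coordinates
  swapped by symmetry, and the right side is minus the form of \<open>- R'\<close>,
  \<open>- R\<close>. They differ by a combination of \<open>A\<close> and \<open>B\<close>, which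
  both vanish.\<close>

lemma form_identity:
  "(t * p + x * q)\<^sup>2 - (R + R') * ((t * p + x * q) * (x * p + t * q)) + (x * p + t * q)\<^sup>2
    = - (p\<^sup>2 + (R + R') * (p * q) + q\<^sup>2)"
proof -
  define \<sigma> A B where "\<sigma> = R + R'" and "A = \<sigma> * t - 2 * x" and "B = x\<^sup>2 - t\<^sup>2 - 1"
  have "(t * p + x * q)\<^sup>2 - \<sigma> * ((t * p + x * q) * (x * p + t * q)) + (x * p + t * q)\<^sup>2
      + (p\<^sup>2 + \<sigma> * (p * q) + q\<^sup>2)
      = (- x * A - B) * (p\<^sup>2 + q\<^sup>2) - (2 * t * A + \<sigma> * B) * (p * q)"
    by (simp add: A_def B_def power2_eq_square algebra_simps)
  moreover have "A = 0" "B = 0" using R_facts norm by (simp_all add: A_def B_def \<sigma>_def)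
  ultimately show ?thesis unfolding \<sigma>_def by simp
qed

definition U where "U = Quat (of_real x) (\<i> * of_real t) 0 0"
definition W1 where "W1 = Quat (\<i> * of_real t) 0 0 (of_real x)"
definition W2 where
  "W2 = Quat ((of_real x + 1) / 2) (- (\<i> * of_real t / 2)) ((of_real x - 1) / 2) (\<i> * of_real t / 2)"
definition W3 where
  "W3 = Quat ((of_real x)\<^sup>2) (- (of_real x * (\<i> * of_real t))) (- ((of_real t)\<^sup>2))
     (of_real x * (\<i> * of_real t))"

text \<open>
  Let \<open>v\<close> be the symmetric real matrix with diagonal \<open>x\<close> and off-diagonal \<open>t\<close>, a translation by
  the same length as \<open>u\<close> along a perpendicular axis. Then \<open>w\<^sub>3 = u\<^sup>-\<^sup>1 v\<close> and
  \<open>w\<^sub>2 = v\<^sup>1\<^sup>/\<^sup>2 u\<^sup>-\<^sup>1\<^sup>/\<^sup>2\<close>, and \<open>w\<^sub>1\<close> is, up to a scalar, a glide reflection along the axis of \<open>v\<close>. The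
  intervals below are those of \<open>v\<close> (of \<open>v\<^sup>1\<^sup>/\<^sup>2\<close> for \<open>w\<^sub>2\<close>), moved by the power of \<open>u\<close> that occurs.
\<close>

lemma U_matrix: "has_matrix U 1 e 0 0 (1 / e)"
  unfolding e'_eq by (simp add: has_matrix_def U_def e_def e'_def flip: mult.assoc)

lemma W1_matrix: "has_matrix W1 \<i> t (- x) (- x) t"
  by (simp add: has_matrix_def W1_def)

lemma W2_matrix: "has_matrix W2 1 ((1 + e') / 2) ((e - 1) / 2) ((1 - e') / 2) ((1 + e) / 2)"
  by (simp add: has_matrix_def W2_def e_def e'_def field_simps flip: mult.assoc)

lemma W3_matrix: "has_matrix W3 1 (x * e') (t * e') (t * e) (x * e)"
  by (simp add: has_matrix_def W3_def e_def e'_def algebra_simps power2_eq_square)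

lemma U_neq_W: "U \<noteq> W1" "U \<noteq> W2" "U \<noteq> W3"
  using x2 t0 by (auto simp: U_def W1_def W2_def W3_def complex_eq_iff)

text \<open>The matrix has eigenvalue \<open>e\<close> at slope -1 and \<open>- 1 / e\<close> at
  slope 1, so \<open>W1\<close> owns the negative interval and its inverse the positive one. The
  inverse of \<open>U\<close> owns the slopes between \<open>- 1 / e\<close> and
  \<open>1 / e\<close>.\<close>

lemma W1_ping_pong:
  assumes ws: "fst ` set ws \<subseteq> {U, W1}" "reduced_word ws" "ws \<noteq> []"
  shows "word_prod ws \<noteq> 1"
proof -
  define F where "F = (\<lambda>s. if s = False then slope_form R R' else slope_form (- R') (- R))"
  have id: "F True (t * p + (- x) * q) ((- x) * p + t * q) = - 1 * F False p q" for p q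
  proof -
    have "- R' * - R = 1" "- R' + - R = - (R + R')" "R * R' = 1"
      using R_facts by (simp_all add: mult.commute)
    \<comment> \<open>Negating \<open>q\<close> changes the sign of the mixed terms, which exchanges
      the positive and the negative interval.\<close>
    then show ?thesis
      using form_identity[of p "- q"]
      by (simp add: F_def slope_form_expand) (simp add: power2_eq_square algebra_simps)
  qed
  have ee: "e\<^sup>2 * (1 / e) = e" "e\<^sup>2 * - (1 / e) = - e" "e > 0"
    using e_ge by (simp_all add: power2_eq_square)
  have det: "t * t - (- x) * (- x) \<noteq> 0" using norm by (simp add: power2_eq_square)
  have order: "e\<^sup>2 * - (1 / e) < - R'" "- R' < - R" "- R < - (1 / e)" "- (1 / e) < 1 / e"
    "1 / e < R" "R < R'" "R' < e\<^sup>2 * (1 / e)"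
    unfolding ee using R_facts e_ge by (simp_all add: e'_eq[symmetric])
  show ?thesis
    using ping_pong_translation[where Fw = F and a = t and b = "- x" and c = "- x" and d = t and k = 1,
        OF ee(3) U_matrix order U_neq_W(1) F_def W1_matrix det _ id ws] by simp
qed

text \<open>The factor \<open>v\<close> acts first, so the repelling interval is that of
  \<open>v\<close>, while the attracting one is shrunk by \<open>e'\<^sup>2\<close>. To make room,
  the inverse of \<open>U\<close> gets the interval from \<open>- e'\<close> to \<open>e'^3\<close>,
  whose endpoints go to \<open>- e\<close> and \<open>e'\<close> under \<open>U\<close>.\<close>

lemma W3_ping_pong:
  assumes ws: "fst ` set ws \<subseteq> {U, W3}" "reduced_word ws" "ws \<noteq> []"
  shows "word_prod ws \<noteq> 1"
proof -
  define F where
    "F = (\<lambda>s. if s = True then slope_form (e'\<^sup>2 * R) (e'\<^sup>2 * R') else slope_form (- R') (- R))"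
  have id: "F True (x * e' * p + t * e' * q) (t * e * p + x * e * q) = - e'\<^sup>2 * F False p q" for p q
  proof -
    \<comment> \<open>\<open>(P, Q)\<close> is the image of \<open>(p, q)\<close> under
      \<open>v\<close>, and \<open>(e' * P, e * Q)\<close> the one under \<open>W3\<close>.\<close>
    define \<sigma> P Q where "\<sigma> = R + R'" and "P = x * p + t * q" and "Q = t * p + x * q"
    have "Q\<^sup>2 - \<sigma> * (Q * P) + P\<^sup>2 = - (p\<^sup>2 + \<sigma> * (p * q) + q\<^sup>2)"
      using form_identity[of p q] by (simp add: \<sigma>_def P_def Q_def)
    moreover have "(e' * P)\<^sup>2 - e'\<^sup>2 * \<sigma> * ((e' * P) * (e * Q)) + e'^4 * (e * Q)\<^sup>2
        = e'\<^sup>2 * ((e * e' * Q)\<^sup>2 - \<sigma> * (e * e' * Q * P) + P\<^sup>2)"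
      by (simp add: power2_eq_square power4_eq_xxxx algebra_simps)
    ultimately have "(e' * P)\<^sup>2 - e'\<^sup>2 * \<sigma> * ((e' * P) * (e * Q)) + e'^4 * (e * Q)\<^sup>2
        = - e'\<^sup>2 * (p\<^sup>2 + \<sigma> * (p * q) + q\<^sup>2)"
      by (simp add: ee' right_diff_distrib distrib_left)
    moreover have "- R' * - R = 1" "- R' + - R = - \<sigma>" "e'\<^sup>2 * R + e'\<^sup>2 * R' = e'\<^sup>2 * \<sigma>"
      "e'\<^sup>2 * R * (e'\<^sup>2 * R') = e'^4"
      using R_facts by (simp_all add: \<sigma>_def algebra_simps power4_eq_xxxx power2_eq_square)
    moreover have "x * e' * p + t * e' * q = e' * P" "t * e * p + x * e * q = e * Q"
      by (simp_all add: P_def Q_def algebra_simps)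
    ultimately show ?thesis by (simp add: F_def slope_form_expand)
  qed
  have e0: "e > 0" "e' > 0" using e_ge by (simp_all flip: e'_eq)
  have ee: "e\<^sup>2 * e'^3 = e'" "e\<^sup>2 * - e' = - e"
    using ee'_powers by simp_all
  have det: "x * e' * (x * e) - t * e' * (t * e) \<noteq> 0"
  proof -
    have "x * e' * (x * e) - t * e' * (t * e) = (e * e') * (x\<^sup>2 - t\<^sup>2)"
      by (simp add: power2_eq_square algebra_simps)
    then show ?thesis unfolding norm ee' by simp
  qed
  have cube: "e'\<^sup>2 * e' = e'^3" "e'^3 > 0"
    using e0 by (simp_all add: power2_eq_square power3_eq_cube)
  have mono: "e'\<^sup>2 * e' < e'\<^sup>2 * R" "e'\<^sup>2 * R < e'\<^sup>2 * R'" "e'\<^sup>2 * R' < e'\<^sup>2 * e"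
    using e0 R_facts by (intro mult_strict_left_mono; simp)+
  have order: "e\<^sup>2 * - e' < - R'" "- R' < - R" "- R < - e'" "- e' < e'^3"
    "e'^3 < e'\<^sup>2 * R" "e'\<^sup>2 * R < e'\<^sup>2 * R'" "e'\<^sup>2 * R' < e\<^sup>2 * e'^3"
    unfolding ee using R_facts(4-6) e0 cube mono(2) mono(1)[unfolded cube] mono(3)[unfolded ee'_powers]
    by linarith+
  show ?thesis
    using ping_pong_translation[where Fw = F and a = "x * e'" and b = "t * e'" and c = "t * e"
        and d = "x * e" and k = "e'\<^sup>2",
        OF e0(1) U_matrix order U_neq_W(3) F_def W3_matrix det _ id ws] e0 by simp
qed

text \<open>With \<open>f\<close> in place of \<open>e\<close>, \<open>r\<close> and
  \<open>r'\<close> are the \<open>R\<close> and \<open>R'\<close> of the square root of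
  \<open>v\<close>. This root acts last, so the attracting interval stays, while the repelling one
  is stretched by \<open>e\<close>. The inverse of \<open>U\<close> gets the interval from -1 to
  \<open>e'\<close>.\<close>

lemma W2_ping_pong:
  assumes ws: "fst ` set ws \<subseteq> {U, W2}" "reduced_word ws" "ws \<noteq> []"
  shows "word_prod ws \<noteq> 1"
proof -
  define f where "f = sqrt e"
  have e0: "e > 0" "e' > 0" using e_ge by (simp_all flip: e'_eq)
  have ff: "f\<^sup>2 = e" "f \<ge> 0" using e0 by (simp_all add: f_def)
  have "(19/10)\<^sup>2 < f\<^sup>2" unfolding ff using e_ge by (simp add: power2_eq_square)
  then have f: "f > 19/10" by (rule power_less_imp_less_base) (use ff in simp)
  define r r' where "r = (f - 1) / (f + 1)" and "r' = (f + 1) / (f - 1)"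
  have f1: "f - 1 > 0" "f + 1 > 0" using f by simp_all
  then have "r < 1" "1 < r'" by (simp_all add: r_def r'_def)
  then have "r < r'" by simp
  then have r: "r * r' = 1" "r > 0" "r < r'" using f1 by (simp_all add: r_def r'_def)
  have "r * (f + 1) = f - 1" "r' * (f - 1) = f + 1" using f by (simp_all add: r_def r'_def)
  moreover have "(r + r') * ((f + 1) * (f - 1)) = r * (f + 1) * (f - 1) + r' * (f - 1) * (f + 1)"
    by (simp add: algebra_simps)
  ultimately have "(r + r') * ((f + 1) * (f - 1)) = (f - 1) * (f - 1) + (f + 1) * (f + 1)"
    by simp
  moreover have "(f + 1) * (f - 1) = e - 1" "(f - 1) * (f - 1) + (f + 1) * (f + 1) = 2 * (e + 1)"
    unfolding ff(1)[symmetric] by (simp_all add: power2_eq_square algebra_simps)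
  ultimately have sum: "(r + r') * (e - 1) = 2 * (e + 1)" by simp
  \<comment> \<open>The goal \<open>r' < e\<close> means \<open>f^3 > f\<^sup>2 + f + 1\<close>,
    true from about 1.84 on. It fails for the golden ratio, the value of \<open>f\<close> when
    \<open>x = 3/2\<close>.\<close>
  have "f + 1 < f + 19/10 * (e - 1) - e" using e_ge by (simp add: field_simps)
  also have "\<dots> \<le> f + f * (e - 1) - e"
    using f e_ge by (intro diff_right_mono add_left_mono mult_right_mono) auto
  also have "\<dots> = (f - 1) * e" by (simp add: algebra_simps)
  finally have "f + 1 < (f - 1) * e" .
  then have r'e: "r' < e" using f by (simp add: r'_def field_simps)
  then have "e' * (r * r') < e' * (r * e)"
    by (intro mult_strict_left_mono) (use r'e e0 r in auto)
  moreover have "e' * (r * e) = e * e' * r" by simp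
  ultimately have e'r: "e' < r" unfolding r(1) ee' by simp
  define F where
    "F = (\<lambda>s. if s = True then slope_form r r' else slope_form (- (e * r')) (- (e * r)))"
  have id: "F True ((1 + e') / 2 * p + (e - 1) / 2 * q) ((1 - e') / 2 * p + (1 + e) / 2 * q)
      = - e' * F False p q" for p q
  proof -
    define \<tau> where "\<tau> = r + r'"
    \<comment> \<open>\<open>A = 0\<close> is the relation \<open>sum\<close>, and
      \<open>C = 0\<close> is the same relation multiplied by \<open>e'\<close>; the form identity
      holds modulo \<open>A\<close>, \<open>B\<close>, \<open>C\<close>.\<close>
    define A B C where "A = \<tau> * (e - 1) - 2 * (e + 1)" and "B = e * e' - 1"
      and "C = \<tau> * (1 - e') - 2 * (1 + e')"
    have AB: "A = 0" "B = 0" using sum ee' by (simp_all add: \<tau>_def A_def B_def)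
    have "C = e' * A - (\<tau> - 2) * B" by (simp add: A_def B_def C_def algebra_simps)
    then have "C = 0" by (simp add: AB)
    have "((1 + e') * p + (e - 1) * q)\<^sup>2
        - \<tau> * (((1 + e') * p + (e - 1) * q) * ((1 - e') * p + (1 + e) * q))
        + ((1 - e') * p + (1 + e) * q)\<^sup>2 + 4 * e' * (p\<^sup>2 + e * \<tau> * (p * q) + e\<^sup>2 * q\<^sup>2)
        = - (1 + e') * C * p\<^sup>2 + (2 * \<tau> * B - C * (e - 1) - A * (1 - e')) * (p * q)
          + (4 * e * B - A * (1 + e)) * q\<^sup>2"
      by (simp add: A_def B_def C_def power2_eq_square algebra_simps)
    then have "((1 + e') * p + (e - 1) * q)\<^sup>2
        - \<tau> * (((1 + e') * p + (e - 1) * q) * ((1 - e') * p + (1 + e) * q))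
        + ((1 - e') * p + (1 + e) * q)\<^sup>2 = - 4 * e' * (p\<^sup>2 + e * \<tau> * (p * q) + e\<^sup>2 * q\<^sup>2)"
      by (simp add: AB \<open>C = 0\<close>)
    moreover have "F True (a / 2) (b / 2) = (a\<^sup>2 - \<tau> * (a * b) + b\<^sup>2) / 4" for a b
      using r by (simp add: F_def slope_form_expand \<tau>_def power2_eq_square field_simps)
    moreover have "F False p q = p\<^sup>2 + e * \<tau> * (p * q) + e\<^sup>2 * (r * r') * q\<^sup>2"
      by (simp add: F_def slope_form_expand \<tau>_def power2_eq_square algebra_simps)
    moreover have "(1 + e') / 2 * p + (e - 1) / 2 * q = ((1 + e') * p + (e - 1) * q) / 2"
      "(1 - e') / 2 * p + (1 + e) / 2 * q = ((1 - e') * p + (1 + e) * q) / 2"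
      by (simp_all add: field_simps)
    ultimately show ?thesis using r by (simp only: mult_1_right)
  qed
  have det: "(1 + e') / 2 * ((1 + e) / 2) - (e - 1) / 2 * ((1 - e') / 2) \<noteq> 0"
  proof -
    have "(1 + e') / 2 * ((1 + e) / 2) - (e - 1) / 2 * ((1 - e') / 2) = 1"
      using ee' by (simp add: field_simps)
    then show ?thesis by simp
  qed
  have "e * r' < e * e" "e * r < e * r'" "e * e' < e * r"
    using e0 r r'e e'r by (intro mult_strict_left_mono; simp)+
  then have order: "e\<^sup>2 * - 1 < - (e * r')" "- (e * r') < - (e * r)" "- (e * r) < - 1" "- 1 < e'"
    "e' < r" "r < r'" "r' < e\<^sup>2 * e'"
    unfolding ee'_powers(1) using r e0 r'e e'r ee' by (simp_all add: power2_eq_square)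
  show ?thesis
    using ping_pong_translation[where Fw = F and a = "(1 + e') / 2" and b = "(e - 1) / 2"
        and c = "(1 - e') / 2" and d = "(1 + e) / 2" and k = e',
        OF e0(1) U_matrix order U_neq_W(2) F_def W2_matrix det _ id ws] e0 by simp
qed

lemma qnorm_U_W: "qnorm U = 1" "qnorm W1 = 1" "qnorm W2 = 1" "qnorm W3 = 1"
proof -
  have "(of_real (x\<^sup>2 - t\<^sup>2) :: complex) = 1" by (simp only: norm of_real_1)
  then have c: "(of_real x)\<^sup>2 = 1 + (of_real t :: complex)\<^sup>2" by (simp add: algebra_simps)
  show "qnorm U = 1" "qnorm W1 = 1" by (simp_all add: qnorm_def U_def W1_def c power_mult_distrib)
  have "qnorm W2 = ((of_real x)\<^sup>2 - (of_real t)\<^sup>2 + 1) / 2"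
    by (simp add: qnorm_def W2_def power2_eq_square field_simps)
  then show "qnorm W2 = 1" by (simp add: c)
  have "qnorm W3 = ((of_real x)\<^sup>2 - (of_real t)\<^sup>2)\<^sup>2"
    by (simp add: qnorm_def W3_def power2_eq_square algebra_simps)
  then show "qnorm W3 = 1" by (simp add: c)
qed

text \<open>A general subring \<open>S\<close> covers both the field and its ring of integers.
  Halves of the coordinates occur in \<open>W2\<close> only.\<close>

lemma freely_generate_subgroup_U_W:
  assumes S: "is_subring S" "of_real x \<in> S" "\<i> * of_real t \<in> S"
    and w: "w = W1 \<or> w = W2 \<and> (of_real x + 1) / 2 \<in> S \<and> \<i> * of_real t / 2 \<in> S \<or> w = W3"
  shows "freely_generate_subgroup (units_of (quat_ring S)) U w"
proof -
  note ring = is_subringD[OF S(1)]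
  have U: "U \<in> carrier (quat_ring S)" using S ring by (simp add: U_def)
  consider "w = W1" | "w = W2" "(of_real x + 1) / 2 \<in> S" "\<i> * of_real t / 2 \<in> S" | "w = W3"
    using w by blast
  then show ?thesis
  proof cases
    case 1
    then have "w \<in> carrier (quat_ring S)" using S ring by (simp add: W1_def)
    then show ?thesis
      using freely_generate_subgroup_quatI[OF S(1) U] qnorm_U_W U_neq_W W1_ping_pong 1 by blast
  next
    case 2
    have "(of_real x + 1) / 2 - 1 \<in> S" using ring(4)[OF 2(2) ring(1)] .
    moreover have "(of_real x + 1) / 2 - 1 = (of_real x - 1) / (2 :: complex)" by (simp add: field_simps)
    ultimately have "w \<in> carrier (quat_ring S)" using 2 ring by (simp add: W2_def)
    then show ?thesis
      using freely_generate_subgroup_quatI[OF S(1) U] qnorm_U_W U_neq_W W2_ping_pong 2 by blast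
  next
    case 3
    have "- ((of_real t)\<^sup>2) = \<i> * of_real t * (\<i> * of_real t)"
      by (simp add: power2_eq_square algebra_simps)
    then have "- ((of_real t)\<^sup>2) \<in> S" using ring(6)[OF S(3,3)] by simp
    then have "w \<in> carrier (quat_ring S)"
      using 3 S ring(6)[OF S(2,2)] ring(6)[OF S(2,3)] ring(3)[OF ring(6)[OF S(2,3)]]
      by (simp add: W3_def power2_eq_square)
    then show ?thesis
      using freely_generate_subgroup_quatI[OF S(1) U] qnorm_U_W U_neq_W W3_ping_pong 3 by blast
  qed
qed

end

section \<open>From rational coordinates to the imaginary quadratic field and its integers\<close>

lemma complex_of_real_of_rat: "complex_of_real (of_rat q) = of_rat q"
proof -
  obtain a b where "q = of_int a / of_int b"
    using quotient_of_div by (metis surj_pair)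
  then show ?thesis by (simp add: of_rat_divide)
qed

lemma algebraic_int_if_square_int:
  fixes z :: "'a::field_char_0"
  assumes "z\<^sup>2 = of_int m"
  shows "algebraic_int z"
  by (rule algebraic_int.intros[of "[:- of_int m, 0, 1:]"])
    (use assms in \<open>auto simp: coeff_pCons power2_eq_square split: nat.split\<close>)

text \<open>The generators need not have integral coordinates: \<open>d = 21\<close> has the
  fundamental unit \<open>(5 + sqrt 21) / 2\<close>, and \<open>d = 3\<close> gives
  \<open>(x + 1) / 2 = 3/2\<close>. Hence the claim over the ring of integers assumes integrality,
  and the claim over the field covers every case.\<close>

theorem theorem3p9:
  fixes d :: int and x y :: rat and s X Y :: complex and u w w1 w2 w3 :: "complex quat"
  assumes "d > 1" and "squarefree d"
    and "is_fundamental_unit d (of_rat x + of_rat y * sqrt (of_int d))"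
    and "x > 0" and "y > 0"
    and "x\<^sup>2 - of_int d * y\<^sup>2 = 1"
    and "s = csqrt (- of_int d)" and "X = of_rat x" and "Y = of_rat y"
    and "u = Quat X (Y * s) 0 0"
    and "w1 = Quat (Y * s) 0 0 X"
    and "w2 = Quat ((X + 1) / 2) (- (Y * s / 2)) ((X - 1) / 2) (Y * s / 2)"
    and "w3 = Quat (X\<^sup>2) (- (X * Y * s)) (- (Y\<^sup>2 * of_int d)) (X * Y * s)"
    and "w \<in> {w1, w2, w3}"
  shows
    "(x \<in> \<int> \<and> (w = w2 \<longrightarrow> (x + 1) / 2 \<in> \<int>) \<longrightarrow>
        freely_generate_subgroup (units_of (quat_ring (quad_integers s))) u w) \<and>
     freely_generate_subgroup (units_of (quat_ring (quad_field s))) u w"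
proof -
  define r where "r = sqrt (of_int d)"
  define \<xi> \<tau> where "\<xi> = real_of_rat x" and "\<tau> = real_of_rat y * r"
  have r2: "r\<^sup>2 = of_int d" using \<open>d > 1\<close> by (simp add: r_def)
  have "x \<ge> 2"
    using fundamental_unit_norm_one_ge_2 assms(1-6) by blast
  have "(of_rat (x\<^sup>2 - of_int d * y\<^sup>2) :: real) = 1"
    by (simp only: assms(6) of_rat_1)
  then have norm: "\<xi>\<^sup>2 - \<tau>\<^sup>2 = 1"
    by (simp add: \<xi>_def \<tau>_def r2 of_rat_diff of_rat_mult of_rat_power power_mult_distrib mult.commute)
  have "of_rat 2 \<le> \<xi>" unfolding \<xi>_def of_rat_less_eq by fact
  moreover have "\<tau> > 0" using \<open>y > 0\<close> \<open>d > 1\<close> by (simp add: \<tau>_def r_def)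
  ultimately interpret hyperbola_point \<xi> \<tau> "\<xi> + \<tau>" "\<xi> - \<tau>"
    using norm by unfold_locales simp_all
  have s: "s = \<i> * of_real r"
    using \<open>d > 1\<close> by (simp add: assms(7) r_def csqrt_of_real_nonpos)
  have X: "X = of_real \<xi>" by (simp add: assms(8) \<xi>_def complex_of_real_of_rat)
  have Ys: "Y * s = \<i> * of_real \<tau>" by (simp add: assms(9) \<tau>_def s complex_of_real_of_rat)
  have "(of_real \<tau> :: complex) = Y * of_real r" by (simp add: assms(9) \<tau>_def complex_of_real_of_rat)
  moreover have "(of_real r :: complex)\<^sup>2 = of_int d" by (simp flip: of_real_power add: r2)
  ultimately have Yd: "Y\<^sup>2 * of_int d = (of_real \<tau>)\<^sup>2" by (simp add: power_mult_distrib)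
  have u: "u = U" using assms(10) by (simp add: U_def X Ys)
  have ws: "w1 = W1" "w2 = W2" "w3 = W3"
    using assms(11-13) by (simp_all add: W1_def W2_def W3_def X Ys Yd mult.assoc)
  have s2: "s\<^sup>2 = of_rat (of_int (- d))"
    by (simp add: s power_mult_distrib r2 of_rat_minus flip: of_real_power)
  note ring = is_subring_quad_field[OF s2] is_subring_quad_integers[OF s2]
  have field: "X \<in> quad_field s" "Y * s \<in> quad_field s" "(X + 1) / 2 \<in> quad_field s" "Y * s / 2 \<in> quad_field s"
    using quad_fieldI[of X x 0 s] quad_fieldI[of "Y * s" 0 y s]
      quad_fieldI[of "(X + 1) / 2" "(x + 1) / 2" 0 s] quad_fieldI[of "Y * s / 2" 0 "y / 2" s]
    by (simp_all add: assms(8,9) of_rat_divide of_rat_add)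
  have "freely_generate_subgroup (units_of (quat_ring (quad_field s))) u w"
    unfolding u using field assms(14)
    by (intro freely_generate_subgroup_U_W ring) (auto simp: X Ys ws)
  moreover have "freely_generate_subgroup (units_of (quat_ring (quad_integers s))) u w"
    if x: "x \<in> \<int>" and w: "w = w2 \<longrightarrow> (x + 1) / 2 \<in> \<int>"
  proof -
    \<comment> \<open>The square of \<open>Y * s\<close> is \<open>- d * y\<^sup>2\<close>, which
      the norm equation expresses by \<open>x\<close> alone; this makes \<open>Y * s\<close> an
      algebraic integer.\<close>
    have Ys2: "(Y * s)\<^sup>2 = of_rat (1 - x\<^sup>2)"
    proof -
      have "(Y * s)\<^sup>2 = of_rat (- (of_int d * y\<^sup>2))"
        by (simp add: power_mult_distrib s2 assms(9) of_rat_minus of_rat_mult of_rat_power)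
      then show ?thesis using assms(6) by (simp add: algebra_simps)
    qed
    obtain n where n: "x = of_int n" using x by (rule Ints_cases)
    have "X \<in> \<int>" by (simp add: assms(8) n)
    then have 1: "X \<in> quad_integers s"
      using field by (simp add: quad_integers_def int_imp_algebraic_int)
    have "(Y * s)\<^sup>2 = of_int (1 - n\<^sup>2)" by (simp add: Ys2 n of_rat_diff of_rat_power)
    then have "algebraic_int (Y * s)" by (rule algebraic_int_if_square_int)
    then have 2: "Y * s \<in> quad_integers s" using field by (simp add: quad_integers_def)
    have 3: "(X + 1) / 2 \<in> quad_integers s \<and> Y * s / 2 \<in> quad_integers s" if "w = w2"
    proof -
      obtain m where m: "(x + 1) / 2 = of_int m" using w \<open>w = w2\<close> by (auto elim: Ints_cases)
      then have xm: "x = of_int (2 * m - 1)" by simp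
      have "(X + 1) / 2 = of_int m" by (simp add: assms(8) xm of_rat_diff of_rat_mult)
      then have "(X + 1) / 2 \<in> quad_integers s"
        using field(3) by (simp add: quad_integers_def int_imp_algebraic_int)
      \<comment> \<open>For odd \<open>x\<close> the square of \<open>Y * s\<close> is divisible by
        4, so its half is an algebraic integer too.\<close>
      moreover have "1 - x\<^sup>2 = 4 * of_int (m - m\<^sup>2)"
        by (simp add: xm power2_eq_square algebra_simps)
      then have "(Y * s)\<^sup>2 = 4 * of_int (m - m\<^sup>2)" by (simp only: Ys2 of_rat_mult of_rat_of_int_eq of_rat_numeral_eq)
      then have "(Y * s / 2)\<^sup>2 = of_int (m - m\<^sup>2)" by (simp add: power_divide)
      then have "algebraic_int (Y * s / 2)" by (rule algebraic_int_if_square_int)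
      then have "Y * s / 2 \<in> quad_integers s" using field(4) by (simp add: quad_integers_def)
      ultimately show ?thesis ..
    qed
    show ?thesis
      unfolding u using 1 2 3 assms(14)
      by (intro freely_generate_subgroup_U_W ring) (auto simp: X Ys ws)
  qed
  ultimately show ?thesis by blast
qed

end
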